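(* Let $n$ and $r$ be positive integers. Let $P(n,r)$ denote the number of lattice paths in the plane using unit steps $(1,0)$ and $(0,1)$ from $(0,0)$ to $(n+r,\,n+r-1)$ that never touch any point of the set $\{(x,x)\in\mathbb{Z}^2 : x\ge r\}$. For positive integers $a,b$, let $Q(a,b)$ denote the number of lattice paths in the plane using unit steps $(1,0)$ and $(0,1)$ from $(0,0)$ to $(a+b,\,a+b-1)$ that never touch any point of the set $\{(x,x)\in\mathbb{Z}^2 : 1\le x\le b\}$. Then \[ P(n,r)=Q(r,n), \] i.e., $P(n,r)$ equals the number of such lattice paths from $(0,0)$ to $(n+r,\,n+r-1)$ that never touch any point of $\{(x,x)\in\mathbb{Z}^2 : 1\le x\le n\}$.
   Context: $P(n,r)$ is called the Gessel number. *)

theory Defs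
  imports Main
begin

definition unit_step :: "int \<times> int \<Rightarrow> int \<times> int \<Rightarrow> bool" where
  "unit_step p q \<longleftrightarrow> q = (fst p + 1, snd p) \<or> q = (fst p, snd p + 1)"

text \<open>A path is the list of the lattice points it visits, both endpoints included.\<close>

definition lattice_paths :: "int \<times> int \<Rightarrow> int \<times> int \<Rightarrow> (int \<times> int) list set" where
  "lattice_paths p q =
     {ps. ps \<noteq> [] \<and> hd ps = p \<and> last ps = q \<and> successively unit_step ps}"

definition paths_avoiding ::
  "int \<times> int \<Rightarrow> int \<times> int \<Rightarrow> (int \<times> int) set \<Rightarrow> (int \<times> int) list set" where
  "paths_avoiding p q S = {ps \<in> lattice_paths p q. set ps \<inter> S = {}}"

definition gessel_P :: "nat \<Rightarrow> nat \<Rightarrow> nat" where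
  "gessel_P n r =
     card (paths_avoiding (0, 0) (int n + int r, int n + int r - 1) {(x, x) | x. x \<ge> int r})"

definition gessel_Q :: "nat \<Rightarrow> nat \<Rightarrow> nat" where
  "gessel_Q a b =
     card (paths_avoiding (0, 0) (int a + int b, int a + int b - 1)
       {(x, x) | x. 1 \<le> x \<and> x \<le> int b})"

text \<open>The path sets are finite, so the cardinalities above are genuine counts.\<close>

lemma lattice_paths_bounds:
  assumes "ps \<noteq> []" "successively unit_step ps"
  shows "set ps \<subseteq> {fst (hd ps)..fst (last ps)} \<times> {snd (hd ps)..snd (last ps)} \<and>
         int (length ps) = fst (last ps) - fst (hd ps) + (snd (last ps) - snd (hd ps)) + 1"
  using assms
proof (induction ps)
  case Nil
  then show ?case by simp
next
  case (Cons p ps)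
  show ?case
  proof (cases ps)
    case Nil
    then show ?thesis by (cases p) simp
  next
    case (Cons q qs)
    with Cons.prems have "unit_step p (hd ps)" "successively unit_step ps" "ps \<noteq> []"
      by auto
    with Cons.IH have IH: "set ps \<subseteq> {fst (hd ps)..fst (last ps)} \<times> {snd (hd ps)..snd (last ps)}"
      "int (length ps) = fst (last ps) - fst (hd ps) + (snd (last ps) - snd (hd ps)) + 1"
      by auto
    have s: "hd ps = (fst p + 1, snd p) \<or> hd ps = (fst p, snd p + 1)"
      using \<open>unit_step p (hd ps)\<close> by (simp add: unit_step_def)
    have "last ps \<in> set ps" using \<open>ps \<noteq> []\<close> by simp
    then have "fst (hd ps) \<le> fst (last ps)" "snd (hd ps) \<le> snd (last ps)"
      using subsetD[OF IH(1)] by (auto simp: mem_Times_iff)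
    then have "p \<in> {fst p..fst (last ps)} \<times> {snd p..snd (last ps)}"
      using s by (auto simp: mem_Times_iff)
    moreover have "set ps \<subseteq> {fst p..fst (last ps)} \<times> {snd p..snd (last ps)}"
      using IH(1) s by (fastforce simp: subset_iff)
    ultimately show ?thesis
      using IH(2) s \<open>ps \<noteq> []\<close> by auto
  qed
qed

lemma finite_lattice_paths: "finite (lattice_paths p q)"
proof (rule finite_subset)
  show "lattice_paths p q \<subseteq> {ps. set ps \<subseteq> {fst p..fst q} \<times> {snd p..snd q} \<and>
      length ps = nat (fst q - fst p + (snd q - snd p) + 1)}"
    using lattice_paths_bounds by (fastforce simp: lattice_paths_def)
  show "finite {ps. set ps \<subseteq> {fst p..fst q} \<times> {snd p..snd q} \<and>
      length ps = nat (fst q - fst p + (snd q - snd p) + 1)}"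
    by (intro finite_lists_length_eq) auto
qed

lemma finite_paths_avoiding: "finite (paths_avoiding p q S)"
  unfolding paths_avoiding_def
  by (rule finite_subset[OF _ finite_lattice_paths[of p q]]) auto

end

theory Submission
  imports Defs
begin

text \<open>
  In the coordinates (time, height) = (x + y, x - y) both counts concern \<open>\<plusminus>1\<close>-walks from height 0
  to height 1 in 2n + 2r - 1 steps. Write T for the step operator on functions of the height, K for
  the step operator that also kills the walk at height 0, and \<open>\<delta>\<^sub>a\<close> for the indicator of a. Splitting
  the walks at time 2r, respectively 2n, and using the symmetry of T and K, one gets
  \<open>P(n,r) = \<Sum>h. (K^(2n-1) \<delta>\<^sub>1)(h) * (T^(2r) \<delta>\<^sub>0)(h)\<close> and
  \<open>Q(r,n) = \<Sum>h. (K^(2n) \<delta>\<^sub>0)(h) * (T^(2r-1) \<delta>\<^sub>1)(h)\<close>.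
  Decomposing by the first step and reflecting, \<open>(K^(m+1) \<delta>\<^sub>0)(h) = (K^m \<delta>\<^sub>1)(h) + (K^m \<delta>\<^sub>1)(-h)\<close>,
  and likewise for T; hence both sums equal
  \<open>\<Sum>h. (K^(2n-1) \<delta>\<^sub>1)(h) * ((T^(2r-1) \<delta>\<^sub>1)(h) + (T^(2r-1) \<delta>\<^sub>1)(-h))\<close>.
\<close>

text \<open>A step tests only the height it reaches, so the initial weights \<open>g\<close> are
  exempt from killing. Hence the counts after one phase can serve as \<open>g\<close> for a phase
  with other forbidden heights.\<close>

primrec walks :: "int set \<Rightarrow> (int \<Rightarrow> nat) \<Rightarrow> nat \<Rightarrow> int \<Rightarrow> nat" where
  "walks Z g 0 h = g h"
| "walks Z g (Suc m) h = (if h \<in> Z then 0 else walks Z g m (h - 1) + walks Z g m (h + 1))"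

definition delta :: "int \<Rightarrow> int \<Rightarrow> nat" where
  "delta a h = of_bool (h = a)"

lemma walks_Suc_start: "walks Z g (Suc m) h = walks Z (walks Z g 1) m h"
  by (induction m arbitrary: h) auto

lemma walks_eq_0:
  assumes "\<bar>h\<bar> > \<bar>a\<bar> + int m"
  shows "walks Z (delta a) m h = 0"
  using assms by (induction m arbitrary: h) (auto simp: delta_def)

text \<open>The start 0 may lie in \<open>Z\<close>, so the cases \<open>{}\<close> and
  \<open>{0}\<close> are both covered.\<close>

lemma walks_delta_0_Suc:
  assumes "1 \<notin> Z" and "\<And>h. - h \<in> Z \<longleftrightarrow> h \<in> Z"
  shows "walks Z (delta 0) (Suc m) h = walks Z (delta 1) m h + walks Z (delta 1) m (- h)"
proof (induction m arbitrary: h)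
  case 0
  have "- 1 \<notin> Z" using assms by simp
  then show ?case using assms(1) by (auto simp: delta_def)
next
  case (Suc m)
  have "- h - 1 = - (h + 1)" "- h + 1 = - (h - 1)" by simp_all
  then show ?case
    using assms(2)[of h] Suc[of "h - 1"] Suc[of "h + 1"]
    by (simp only: walks.simps(2)[of Z _ "Suc m" h] walks.simps(2)[of Z "delta 1" m]) auto
qed

lemma sum_shift:
  fixes b g :: "int \<Rightarrow> nat"
  assumes "\<And>h. \<bar>h\<bar> \<ge> M \<Longrightarrow> b h = 0"
  shows "(\<Sum>h\<in>{-M..M}. b h * g (h + 1)) = (\<Sum>h\<in>{-M..M}. b (h - 1) * g h)"
proof -
  have "(\<Sum>h\<in>{-M..M}. b h * g (h + 1)) = (\<Sum>h\<in>{-M+1..M+1}. b (h - 1) * g h)"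
    by (rule sum.reindex_bij_witness[of _ "\<lambda>h. h - 1" "\<lambda>h. h + 1"]) auto
  \<comment> \<open>The term at \<open>-M\<close> carries \<open>b (- M - 1) = 0\<close>; the one at
    \<open>M + 1\<close>, dropped next, carries \<open>b M = 0\<close>.\<close>
  also have "\<dots> = (\<Sum>h\<in>{-M..M+1}. b (h - 1) * g h)"
    by (rule sum.mono_neutral_left) (auto intro!: assms)
  also have "\<dots> = (\<Sum>h\<in>{-M..M}. b (h - 1) * g h)"
    by (rule sum.mono_neutral_right) (auto intro!: assms)
  finally show ?thesis .
qed

lemma sum_reflect: "(\<Sum>h\<in>{-M..M}. f (- h)) = (\<Sum>h\<in>{-M..M::int}. f h)"
  by (rule sum.reindex_bij_witness[of _ uminus uminus]) auto

text \<open>The step operator is its own transpose; \<open>b\<close> vanishes at and beyond the ends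
  of the window, so truncation loses nothing.\<close>

lemma sum_step_adjoint:
  fixes b g :: "int \<Rightarrow> nat"
  assumes "\<And>h. \<bar>h\<bar> \<ge> M \<Longrightarrow> b h = 0"
  shows "(\<Sum>h\<in>{-M..M}. b h * (g (h - 1) + g (h + 1))) =
         (\<Sum>h\<in>{-M..M}. (b (h - 1) + b (h + 1)) * g h)"
proof -
  have "(\<Sum>h\<in>{-M..M}. b h * g (h - 1)) = (\<Sum>h\<in>{-M..M}. b (- h) * g (- (h + 1)))"
    using sum_reflect[of "\<lambda>h. b h * g (h - 1)" M] by (simp add: algebra_simps)
  also have "\<dots> = (\<Sum>h\<in>{-M..M}. b (- (h - 1)) * g (- h))"
    by (rule sum_shift[where b = "\<lambda>h. b (- h)" and g = "\<lambda>h. g (- h)"]) (simp add: assms)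
  also have "\<dots> = (\<Sum>h\<in>{-M..M}. b (h + 1) * g h)"
    using sum_reflect[of "\<lambda>h. b (h + 1) * g h" M] by (simp add: algebra_simps)
  finally have "(\<Sum>h\<in>{-M..M}. b h * g (h - 1)) = (\<Sum>h\<in>{-M..M}. b (h + 1) * g h)" .
  then show ?thesis
    using sum_shift[of M b g, OF assms] by (simp add: algebra_simps sum.distrib)
qed

text \<open>Time reversal: the walk is read backwards from \<open>a\<close>. Its earliest step stays
  explicit as \<open>g (h - 1) + g (h + 1)\<close>, because \<open>h\<close> is subject to killing
  but the initial height is not.\<close>

lemma walks_eq_sum:
  assumes "a \<notin> Z" and "M > \<bar>a\<bar> + int m"
  shows "walks Z g (Suc m) a =
         (\<Sum>h\<in>{-M..M}. walks Z (delta a) m h * (g (h - 1) + g (h + 1)))"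
  using assms(2)
proof (induction m arbitrary: g)
  case 0
  have "(\<Sum>h\<in>{-M..M}. walks Z (delta a) 0 h * (g (h - 1) + g (h + 1))) =
        (\<Sum>h\<in>{-M..M}. if h = a then g (h - 1) + g (h + 1) else 0)"
    by (rule sum.cong) (auto simp: delta_def)
  moreover have "- M \<le> a" "a \<le> M" using 0 by linarith+
  ultimately show ?case using assms(1) by simp
next
  case (Suc m)
  let ?b = "walks Z (delta a) m" and ?g = "walks Z g 1"
  have "walks Z g (Suc (Suc m)) a = walks Z ?g (Suc m) a"
    by (rule walks_Suc_start)
  also have "\<dots> = (\<Sum>h\<in>{-M..M}. ?b h * (?g (h - 1) + ?g (h + 1)))"
    using Suc.prems by (intro Suc.IH) simp
  also have "\<dots> = (\<Sum>h\<in>{-M..M}. (?b (h - 1) + ?b (h + 1)) * ?g h)"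
    using Suc.prems by (intro sum_step_adjoint walks_eq_0) simp
  \<comment> \<open>The killing factor at \<open>h\<close> passes from \<open>?g\<close> to the
    reversed walk.\<close>
  also have "\<dots> = (\<Sum>h\<in>{-M..M}. walks Z (delta a) (Suc m) h * (g (h - 1) + g (h + 1)))"
    by (rule sum.cong) auto
  finally show ?case .
qed

lemma walks_exchange:
  assumes "n > 0" and "r > 0"
  shows "walks {0} (walks {} (delta 0) (2 * r - 1)) (2 * n) 1 =
         walks {} (walks {0} (delta 0) (2 * n)) (2 * r - 1) 1"
proof -
  obtain k where k: "2 * n = Suc k" using assms(1) by (cases "2 * n") auto
  obtain l where l: "2 * r = Suc (Suc l)" using assms(2) by (cases r) auto
  \<comment> \<open>Large enough to exceed both \<open>1 + k\<close> and \<open>1 + l\<close>, the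
    reach of the walks from 1.\<close>
  define M where "M = int k + int l + 3"
  let ?b = "walks {0} (delta 1) k" and ?u = "walks {} (delta 1) (Suc l)"
  let ?f = "walks {0} (delta 0) (Suc k)"
  have "walks {0} (walks {} (delta 0) (Suc l)) (Suc k) 1 =
        (\<Sum>h\<in>{-M..M}. ?b h * walks {} (delta 0) (Suc (Suc l)) h)"
    by (subst walks_eq_sum[where M = M]) (auto simp: M_def)
  also have "\<dots> = (\<Sum>h\<in>{-M..M}. ?b h * (?u h + ?u (- h)))"
    by (subst walks_delta_0_Suc) auto
  also have "\<dots> = (\<Sum>h\<in>{-M..M}. ?u h * ?b h) + (\<Sum>h\<in>{-M..M}. ?u (- h) * ?b h)"
    by (simp only: distrib_left sum.distrib mult.commute)
  also have "(\<Sum>h\<in>{-M..M}. ?u (- h) * ?b h) = (\<Sum>h\<in>{-M..M}. ?u h * ?b (- h))"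
    using sum_reflect[of "\<lambda>h. ?u h * ?b (- h)" M] by simp
  also have "(\<Sum>h\<in>{-M..M}. ?u h * ?b h) + (\<Sum>h\<in>{-M..M}. ?u h * ?b (- h)) =
             (\<Sum>h\<in>{-M..M}. ?u h * (?b h + ?b (- h)))"
    by (simp only: distrib_left sum.distrib)
  also have "\<dots> = (\<Sum>h\<in>{-M..M}. ?u h * ?f h)"
    by (subst walks_delta_0_Suc) auto
  also have "\<dots> = (\<Sum>h\<in>{-M..M}. walks {} (delta 1) l h * (?f (h - 1) + ?f (h + 1)))"
    by (subst sum_step_adjoint) (auto simp: M_def intro!: walks_eq_0)
  also have "\<dots> = walks {} ?f (Suc l) 1"
    by (rule walks_eq_sum[symmetric]) (auto simp: M_def)
  finally show ?thesis using k l by (simp only: diff_Suc_1)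
qed

lemma paths_avoiding_self:
  assumes "p \<notin> S"
  shows "paths_avoiding p p S = {[p]}"
proof -
  have "ps = [p]" if "ps \<in> lattice_paths p p" for ps
  proof -
    have "length ps = 1" "hd ps = p" "ps \<noteq> []"
      using that lattice_paths_bounds[of ps] by (auto simp: lattice_paths_def)
    then show ?thesis by (cases ps) auto
  qed
  then show ?thesis
    using assms by (auto simp: paths_avoiding_def lattice_paths_def)
qed

lemma paths_avoiding_snoc:
  assumes "q \<noteq> p" and "q \<notin> S"
  shows "paths_avoiding p q S =
         (\<lambda>ps. ps @ [q]) ` (paths_avoiding p (fst q - 1, snd q) S \<union>
                            paths_avoiding p (fst q, snd q - 1) S)" (is "?A = ?s ` ?B")
proof
  show "?A \<subseteq> ?s ` ?B"
  proof
    fix ps assume ps: "ps \<in> ?A"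
    then obtain qs where qs: "ps = qs @ [q]"
      by (cases ps rule: rev_cases) (auto simp: paths_avoiding_def lattice_paths_def)
    have "qs \<noteq> []"
      using ps qs assms(1) by (auto simp: paths_avoiding_def lattice_paths_def)
    moreover from this have "unit_step (last qs) q"
      using ps qs by (auto simp: paths_avoiding_def lattice_paths_def successively_append_iff)
    then have "last qs = (fst q - 1, snd q) \<or> last qs = (fst q, snd q - 1)"
      by (cases "last qs") (auto simp: unit_step_def)
    ultimately have "qs \<in> ?B"
      using ps qs by (auto simp: paths_avoiding_def lattice_paths_def successively_append_iff)
    then show "ps \<in> ?s ` ?B" using qs by blast
  qed
  show "?s ` ?B \<subseteq> ?A"
    using assms(2) by (cases q)
      (auto simp: paths_avoiding_def lattice_paths_def successively_append_iff unit_step_def)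
qed

lemma card_paths_avoiding_rec:
  assumes "q \<noteq> p" and "q \<notin> S"
  shows "card (paths_avoiding p q S) =
         card (paths_avoiding p (fst q - 1, snd q) S) + card (paths_avoiding p (fst q, snd q - 1) S)"
proof -
  have "paths_avoiding p (fst q - 1, snd q) S \<inter> paths_avoiding p (fst q, snd q - 1) S = {}"
    by (auto simp: paths_avoiding_def lattice_paths_def)
  then show ?thesis
    unfolding paths_avoiding_snoc[OF assms]
    by (simp add: card_image inj_on_def card_Un_disjoint finite_paths_avoiding)
qed

lemma paths_avoiding_mem_empty: "q \<in> S \<Longrightarrow> paths_avoiding p q S = {}"
  by (auto simp: paths_avoiding_def lattice_paths_def dest: last_in_set)

lemma card_paths_avoiding_start:
  assumes "(0, 0) \<notin> S" and "x + y = 0"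
  shows "card (paths_avoiding (0, 0) (x, y) S) = delta 0 (x - y)"
proof (cases "x = 0")
  case True
  then show ?thesis using assms by (simp add: paths_avoiding_self delta_def)
next
  case False
  have "paths_avoiding (0, 0) (x, y) S = {}"
  proof (rule ccontr)
    assume "paths_avoiding (0, 0) (x, y) S \<noteq> {}"
    then obtain ps where ps: "ps \<noteq> []" "hd ps = (0, 0)" "last ps = (x, y)" "successively unit_step ps"
      by (auto simp: paths_avoiding_def lattice_paths_def)
    then have "(x, y) \<in> set ps" by (metis last_in_set)
    then show False
      using lattice_paths_bounds[OF ps(1,4)] ps(2,3) False assms(2) by auto
  qed
  then show ?thesis using False assms(2) by (simp add: delta_def)
qed

text \<open>Both sides obey the same last-step recursion. As \<open>kill\<close> concerns only times
  after \<open>t\<close>, applications can be chained at a time where the forbidden heights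
  change.\<close>

lemma card_paths_avoiding_walks:
  assumes start: "\<And>x y. x + y = int t \<Longrightarrow> card (paths_avoiding (0, 0) (x, y) S) = g (x - y)"
    and kill: "\<And>x y. int t < x + y \<Longrightarrow> x + y \<le> int t + int m \<Longrightarrow> (x, y) \<in> S \<longleftrightarrow> x - y \<in> Z"
    and "x + y = int t + int m"
  shows "card (paths_avoiding (0, 0) (x, y) S) = walks Z g m (x - y)"
  using kill assms(3)
proof (induction m arbitrary: x y)
  case 0
  then show ?case using start by simp
next
  case (Suc m)
  show ?case
  proof (cases "(x, y) \<in> S")
    case True
    then show ?thesis using Suc.prems by (simp add: paths_avoiding_mem_empty)
  next
    case False
    then have "x - y \<notin> Z" using Suc.prems by simp
    moreover have "card (paths_avoiding (0, 0) (x, y) S) =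
        card (paths_avoiding (0, 0) (x - 1, y) S) + card (paths_avoiding (0, 0) (x, y - 1) S)"
      using False Suc.prems(2) by (subst card_paths_avoiding_rec) auto
    moreover have "card (paths_avoiding (0, 0) (x - 1, y) S) = walks Z g m (x - 1 - y)"
      using Suc.prems by (intro Suc.IH) auto
    moreover have "card (paths_avoiding (0, 0) (x, y - 1) S) = walks Z g m (x - (y - 1))"
      using Suc.prems by (intro Suc.IH) auto
    ultimately show ?thesis by (simp add: algebra_simps)
  qed
qed

lemma gessel_P_eq_walks:
  assumes "r > 0"
  shows "gessel_P n r = walks {0} (walks {} (delta 0) (2 * r - 1)) (2 * n) 1"
proof -
  let ?S = "{(x, x) | x. x \<ge> int r}"
  \<comment> \<open>The first forbidden point \<open>(r, r)\<close> has time 2r, so the first 2r - 1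
    steps are free; from then on the whole diagonal is forbidden.\<close>
  have "card (paths_avoiding (0, 0) (x, y) ?S) = walks {} (delta 0) (2 * r - 1) (x - y)"
    if "x + y = int (2 * r - 1)" for x y
    by (rule card_paths_avoiding_walks[where t = 0])
      (use that assms in \<open>auto intro!: card_paths_avoiding_start\<close>)
  then have "card (paths_avoiding (0, 0) (int n + int r, int n + int r - 1) ?S) =
      walks {0} (walks {} (delta 0) (2 * r - 1)) (2 * n) (int n + int r - (int n + int r - 1))"
    by (rule card_paths_avoiding_walks[where t = "2 * r - 1"]) (use assms in auto)
  then show ?thesis by (simp add: gessel_P_def)
qed

lemma gessel_Q_eq_walks:
  assumes "r > 0"
  shows "gessel_Q r n = walks {} (walks {0} (delta 0) (2 * n)) (2 * r - 1) 1"
proof -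
  let ?S = "{(x, x) | x. 1 \<le> x \<and> x \<le> int n}"
  \<comment> \<open>At times 1 to 2n every diagonal point is forbidden, later none; the origin is
    exempt as the start.\<close>
  have "card (paths_avoiding (0, 0) (x, y) ?S) = walks {0} (delta 0) (2 * n) (x - y)"
    if "x + y = int (2 * n)" for x y
    by (rule card_paths_avoiding_walks[where t = 0])
      (use that in \<open>auto intro!: card_paths_avoiding_start\<close>)
  then have "card (paths_avoiding (0, 0) (int r + int n, int r + int n - 1) ?S) =
      walks {} (walks {0} (delta 0) (2 * n)) (2 * r - 1) (int r + int n - (int r + int n - 1))"
    by (rule card_paths_avoiding_walks[where t = "2 * n"]) (use assms in auto)
  then show ?thesis by (simp add: gessel_Q_def)
qed

theorem theorem6:
  fixes n r :: nat
  assumes "n > 0" and "r > 0"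
  shows "gessel_P n r = gessel_Q r n"
  using assms by (simp only: gessel_P_eq_walks gessel_Q_eq_walks walks_exchange)

end
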